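(* Let $p$ and $q$ be two distinct prime numbers and let $\alpha\geqslant\beta$ be two positive integers. Then $\psi(p^\alpha q^\beta)=2^\alpha\sum_{i=0}^\beta\binom{\beta}{i}\binom{\alpha+i}{i}$.
   Context: The function $\psi$ on positive integers is defined as follows: $\psi(n)$ is the number of non-empty chains, in the set of positive divisors of $n$ ordered by divisibility, whose largest element is $n$ (including the singleton chain $\{n\}$). Equivalently, $\psi(1)=1$ and $\psi(n)=1+\sum_{d\mid n,\,d\neq n}\psi(d)$. *)

theory Defs
  imports "HOL-Computational_Algebra.Primes"
begin

definition dvd_chains :: "nat \<Rightarrow> nat set set" where
  "dvd_chains n = {C. C \<noteq> {} \<and> C \<subseteq> {d. d dvd n} \<and>
     Complete_Partial_Order.chain (dvd) C \<and> n \<in> C \<and> (\<forall>d\<in>C. d dvd n)}"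

text \<open>Meaningful for positive \<open>n\<close> only: \<open>0\<close> has infinitely many divisors.\<close>

definition psi :: "nat \<Rightarrow> nat" where
  "psi n = card (dvd_chains n)"

lemma dvd_chains_rec:
  assumes n: "n > 0"
  shows "dvd_chains n = insert {n} (\<Union>d\<in>{d. d dvd n \<and> d \<noteq> n}. insert n ` dvd_chains d)"
    (is "_ = ?R")
proof (intro equalityI subsetI)
  fix C assume C: "C \<in> dvd_chains n"
  have sub: "C \<subseteq> {d. d dvd n}" and ch: "Complete_Partial_Order.chain (dvd) C" and nC: "n \<in> C"
    using C by (auto simp: dvd_chains_def)
  have fin: "finite C" using sub n finite_divisors_nat finite_subset by blast
  show "C \<in> ?R"
  proof (cases "C = {n}")
    case False
    define D where "D = C - {n}"
    define m where "m = Max D"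
    have D: "finite D" "D \<noteq> {}" using fin False nC by (auto simp: D_def)
    then have mD: "m \<in> D" and mx: "\<And>x. x \<in> D \<Longrightarrow> x \<le> m" by (auto simp: m_def)
    have pos: "x > 0" if "x \<in> D" for x using that sub n by (auto simp: D_def intro: Nat.gr0I)
    have dv: "x dvd m" if "x \<in> D" for x
    proof -
      have "x dvd m \<or> m dvd x" using ch that mD by (auto simp: chain_def D_def)
      then show ?thesis using mx[OF that] pos[OF that] dvd_imp_le[of m x] by fastforce
    qed
    have "D \<in> dvd_chains m"
      using dv mD D ch by (auto simp: dvd_chains_def chain_def D_def)
    moreover have "C = insert n D" using nC by (auto simp: D_def)
    moreover have "m dvd n" "m \<noteq> n" using mD sub by (auto simp: D_def)
    ultimately show ?thesis by blast
  qed simp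
next
  fix C assume "C \<in> ?R"
  then consider "C = {n}" | d D where "d dvd n" "D \<in> dvd_chains d" "C = insert n D" by blast
  then show "C \<in> dvd_chains n"
  proof cases
    case 1 then show ?thesis by (simp add: dvd_chains_def chain_def)
  next
    case 2 then show ?thesis by (auto simp: dvd_chains_def chain_def intro: dvd_trans)
  qed
qed

lemma finite_dvd_chains: "n > 0 \<Longrightarrow> finite (dvd_chains n)"
  by (rule finite_subset[of _ "Pow {d. d dvd n}"]) (auto simp: dvd_chains_def)

lemma psi_rec:
  assumes n: "n > 0"
  shows "psi n = 1 + (\<Sum>d | d dvd n \<and> d \<noteq> n. psi d)"
proof -
  let ?I = "{d. d dvd n \<and> d \<noteq> n}"
  have finI: "finite ?I" using n by simp
  have notin: "n \<notin> D" if "d \<in> ?I" "D \<in> dvd_chains d" for d D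
    using that by (auto simp: dvd_chains_def dest: dvd_antisym)
  have ne: "D \<noteq> {}" if "D \<in> dvd_chains d" for d D using that by (simp add: dvd_chains_def)
  have pos: "d > 0" if "d \<in> ?I" for d using that n by (auto intro: Nat.gr0I)
  have uniq: "d = e" if "D \<in> dvd_chains d" "D \<in> dvd_chains e" for d e D
    using that by (auto simp: dvd_chains_def intro: dvd_antisym)
  have ins: "D = E" if "insert n D = insert n E" "n \<notin> D" "n \<notin> E" for D E :: "nat set"
    using that by (metis insert_ident)
  have disj: "insert n ` dvd_chains d \<inter> insert n ` dvd_chains e = {}"
    if "d \<in> ?I" "e \<in> ?I" "d \<noteq> e" for d e
    using that notin ins uniq by (smt (verit) disjoint_iff imageE)
  have inj: "inj_on (insert n) (dvd_chains d)" if "d \<in> ?I" for d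
    using notin[OF that] ins by (meson inj_onI)
  have "{n} \<notin> (\<Union>d\<in>?I. insert n ` dvd_chains d)"
  proof
    assume "{n} \<in> (\<Union>d\<in>?I. insert n ` dvd_chains d)"
    then obtain d D where dD: "d \<in> ?I" "D \<in> dvd_chains d" "{n} = insert n D" by blast
    from notin[OF dD(1,2)] ne[OF dD(2)] dD(3) show False by blast
  qed
  moreover have fin: "finite (insert n ` dvd_chains d)" if "d \<in> ?I" for d
    using finite_dvd_chains pos[OF that] by blast
  ultimately have "psi n = 1 + card (\<Union>d\<in>?I. insert n ` dvd_chains d)"
    unfolding psi_def dvd_chains_rec[OF n] using finI by (subst card_insert_disjoint) auto
  also have "card (\<Union>d\<in>?I. insert n ` dvd_chains d) = (\<Sum>d\<in>?I. card (insert n ` dvd_chains d))"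
    using finI fin disj by (intro card_UN_disjoint) auto
  also have "\<dots> = (\<Sum>d\<in>?I. psi d)"
    unfolding psi_def using inj by (intro sum.cong refl card_image) auto
  finally show ?thesis .
qed

lemma psi_1: "psi 1 = 1"
  using psi_rec[of 1] by simp

end

theory Submission
  imports Defs
begin

text \<open>
  Write \<open>f a b\<close> for \<open>psi (p ^ a * q ^ b)\<close>. Since the divisors of \<open>p ^ a * q ^ b\<close> form the grid
  \<open>{..a} \<times> {..b}\<close>, the recursion for \<open>psi\<close> says that twice \<open>f a b\<close> is one more than the sum of
  \<open>f\<close> over the rectangle with corner \<open>(a, b)\<close>. Inclusion-exclusion on the four rectangles with
  corners \<open>(a, b)\<close>, \<open>(a + 1, b)\<close>, \<open>(a, b + 1)\<close> and \<open>(a + 1, b + 1)\<close> eliminates the sums and leaves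
  the recurrence

    \<open>f (a + 1) (b + 1) = 2 * f a (b + 1) + 2 * f (a + 1) b - 2 * f a b\<close>

  (\<open>psi_primepow_mult_recurrence\<close>). Together with the values \<open>2 ^ a\<close> and \<open>2 ^ b\<close> on the two axes it
  determines \<open>f\<close>. The right-hand side of the theorem has the same values on the axes and, by two
  applications of Pascal's rule, satisfies the same recurrence; without the factor \<open>2 ^ a\<close> this is
  \<open>binomial_convolution_recurrence\<close>.
\<close>

section \<open>Divisors of a product of two prime powers\<close>

lemma sum_divisors_primepow_mult:
  fixes p q a b :: nat and f :: "nat \<Rightarrow> 'a :: comm_monoid_add"
  assumes "prime p" and "prime q" and "p \<noteq> q"
  shows "(\<Sum>d | d dvd p ^ a * q ^ b. f d) = (\<Sum>i\<le>a. \<Sum>j\<le>b. f (p ^ i * q ^ j))"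
proof -
  have pq: "coprime (p ^ i) (q ^ j)" for i j
    using assms by (simp add: primes_coprime)
  have inj: "inj_on (\<lambda>(i, j). p ^ i * q ^ j) ({..a} \<times> {..b})"
  proof (rule inj_onI, clarsimp)
    fix i j k l
    assume eq: "p ^ i * q ^ j = p ^ k * q ^ l"
    have "p ^ i dvd p ^ k" "p ^ k dvd p ^ i"
      using eq pq by (metis coprime_dvd_mult_left_iff dvd_triv_left)+
    moreover have "q ^ j dvd q ^ l" "q ^ l dvd q ^ j"
      using eq pq by (metis coprime_commute coprime_dvd_mult_right_iff dvd_triv_right)+
    ultimately show "i = k \<and> j = l"
      using assms(1,2) by (blast intro: le_antisym power_dvd_imp_le prime_gt_1_nat)
  qed
  have "(\<lambda>(i, j). p ^ i * q ^ j) ` ({..a} \<times> {..b}) = {d. d dvd p ^ a * q ^ b}"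
  proof (intro equalityI subsetI)
    fix d assume "d \<in> {d. d dvd p ^ a * q ^ b}"
    then obtain x y where d: "d = x * y" "x dvd p ^ a" "y dvd q ^ b"
      using division_decomp[of d "p ^ a" "q ^ b"] by blast
    then obtain i j where "i \<le> a" "x = p ^ i" "j \<le> b" "y = q ^ j"
      using assms(1,2) by (auto simp: divides_primepow_nat)
    with d show "d \<in> (\<lambda>(i, j). p ^ i * q ^ j) ` ({..a} \<times> {..b})" by force
  qed (auto intro: mult_dvd_mono le_imp_power_dvd)
  with inj have "bij_betw (\<lambda>(i, j). p ^ i * q ^ j) ({..a} \<times> {..b}) {d. d dvd p ^ a * q ^ b}"
    by (simp add: bij_betw_def)
  then show ?thesis
    by (simp add: sum.cartesian_product split_beta flip: sum.reindex_bij_betw)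
qed

section \<open>The recurrence for chains of divisors\<close>

text \<open>Including the top term \<open>d = n\<close> in the recursion for \<open>psi\<close> makes the sum run over all divisors,
  hence over a full rectangle of exponents when \<open>n\<close> is a product of two prime powers.\<close>

lemma double_psi_eq_sum_divisors:
  assumes "n > 0"
  shows "2 * psi n = 1 + (\<Sum>d | d dvd n. psi d)"
proof -
  have "{d. d dvd n} = insert n {d. d dvd n \<and> d \<noteq> n}" by auto
  moreover have "finite {d. d dvd n \<and> d \<noteq> n}" using assms by simp
  ultimately have "(\<Sum>d | d dvd n. psi d) = psi n + (\<Sum>d | d dvd n \<and> d \<noteq> n. psi d)"
    by (simp only:) simp
  then show ?thesis using psi_rec[OF assms] by simp
qed

lemma double_psi_primepow_mult:
  fixes p q a b :: nat
  assumes "prime p" and "prime q" and "p \<noteq> q"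
  shows "2 * psi (p ^ a * q ^ b) = 1 + (\<Sum>i\<le>a. \<Sum>j\<le>b. psi (p ^ i * q ^ j))"
  using assms by (simp add: double_psi_eq_sum_divisors sum_divisors_primepow_mult prime_gt_0_nat)

text \<open>The rectangles with corners \<open>(a, Suc b)\<close> and \<open>(Suc a, b)\<close> overlap in the one with corner
  \<open>(a, b)\<close>, and their union lacks only the corner cell of the one with corner \<open>(Suc a, Suc b)\<close>.
  In this inclusion-exclusion the four constants \<open>1\<close> cancel.\<close>

lemma psi_primepow_mult_recurrence:
  fixes p q a b :: nat
  assumes "prime p" and "prime q" and "p \<noteq> q"
  shows "psi (p ^ Suc a * q ^ Suc b) + 2 * psi (p ^ a * q ^ b)
    = 2 * psi (p ^ a * q ^ Suc b) + 2 * psi (p ^ Suc a * q ^ b)"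
proof -
  define f where "f i j = psi (p ^ i * q ^ j)" for i j
  have f: "2 * f i j = 1 + (\<Sum>k\<le>i. \<Sum>l\<le>j. f k l)" for i j
    unfolding f_def by (rule double_psi_primepow_mult[OF assms])
  have "f (Suc a) (Suc b) + 2 * f a b = 2 * f a (Suc b) + 2 * f (Suc a) b"
    using f[of a b] f[of a "Suc b"] f[of "Suc a" b] f[of "Suc a" "Suc b"]
    by (simp add: sum.distrib)
  then show ?thesis by (simp only: f_def)
qed

text \<open>For a single prime the rectangle is a segment, and subtracting the formulas for two successive
  segments leaves \<open>psi (p ^ Suc n) = 2 * psi (p ^ n)\<close>.\<close>

lemma psi_primepow:
  fixes p n :: nat
  assumes "prime p"
  shows "psi (p ^ n) = 2 ^ n"
proof (induction n)
  case 0
  show ?case using psi_1 by simp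
next
  case (Suc n)
  \<comment> \<open>An arbitrary second prime with exponent \<open>0\<close> reduces to the case of two primes.\<close>
  obtain q :: nat where q: "prime q" "q > p" using bigger_prime by blast
  have "2 * psi (p ^ k) = 1 + (\<Sum>i\<le>k. psi (p ^ i))" for k
    using double_psi_primepow_mult[OF assms q(1), of k 0] q(2) by simp
  from this[of n] this[of "Suc n"] Suc.IH show ?case by simp
qed

section \<open>The recurrence for the binomial sum\<close>

text \<open>By Pascal's rule for \<open>Suc b choose i\<close>, raising \<open>b\<close> adds a copy of the sum with the second
  binomial coefficient shifted by one.\<close>

lemma binomial_convolution_Suc:
  fixes a b :: nat
  shows "(\<Sum>i\<le>Suc b. (Suc b choose i) * ((a + i) choose i))
    = (\<Sum>i\<le>b. (b choose i) * ((a + i) choose i))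
      + (\<Sum>i\<le>b. (b choose i) * ((a + Suc i) choose Suc i))"
proof -
  \<comment> \<open>Summing up to \<open>Suc b\<close> is harmless, because \<open>b choose Suc b = 0\<close>.\<close>
  have "(\<Sum>i\<le>b. (b choose i) * ((a + i) choose i)) = (\<Sum>i\<le>Suc b. (b choose i) * ((a + i) choose i))"
    by simp
  also have "\<dots> = 1 + (\<Sum>i\<le>b. (b choose Suc i) * ((a + Suc i) choose Suc i))"
    by (simp only: sum.atMost_Suc_shift) simp
  finally show ?thesis
    by (simp only: sum.atMost_Suc_shift) (simp add: sum.distrib algebra_simps)
qed

text \<open>The increments in \<open>b\<close> at \<open>a\<close> and at \<open>Suc a\<close> are the shifted sums of the preceding lemma.
  Pascal's rule for \<open>Suc (a + Suc i) choose Suc i\<close> shows that they differ by the sum at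
  \<open>(Suc a, b)\<close>.\<close>

lemma binomial_convolution_recurrence:
  fixes a b :: nat
  defines "h \<equiv> \<lambda>a b. \<Sum>i\<le>b. (b choose i) * ((a + i) choose i)"
  shows "h (Suc a) (Suc b) + h a b = h a (Suc b) + 2 * h (Suc a) b"
proof -
  have "(\<Sum>i\<le>b. (b choose i) * ((Suc a + Suc i) choose Suc i))
      = h (Suc a) b + (\<Sum>i\<le>b. (b choose i) * ((a + Suc i) choose Suc i))"
    by (simp add: h_def sum.distrib algebra_simps)
  then show ?thesis
    unfolding h_def using binomial_convolution_Suc[of b a] binomial_convolution_Suc[of b "Suc a"]
    by linarith
qed

section \<open>The closed form\<close>

theorem theorem5p5:
  fixes p q \<alpha> \<beta> :: nat
  assumes "prime p" and "prime q" and "p \<noteq> q"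
    and "\<alpha> \<ge> \<beta>" and "\<alpha> > 0" and "\<beta> > 0"
  shows "psi (p ^ \<alpha> * q ^ \<beta>) = 2 ^ \<alpha> * (\<Sum>i=0..\<beta>. (\<beta> choose i) * ((\<alpha> + i) choose i))"
proof -
  define h :: "nat \<Rightarrow> nat \<Rightarrow> nat" where "h = (\<lambda>a b. \<Sum>i\<le>b. (b choose i) * ((a + i) choose i))"
  have "psi (p ^ a * q ^ b) = 2 ^ a * h a b" for a b
  proof (induction a arbitrary: b)
    case 0
    have "h 0 b = 2 ^ b" by (simp add: h_def choose_row_sum)
    then show ?case using psi_primepow[OF assms(2)] by simp
  next
    case (Suc a)
    note row = Suc.IH
    show ?case
    proof (induction b)
      case 0
      show ?case using psi_primepow[OF assms(1), of "Suc a"] by (simp add: h_def)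
    next
      case (Suc b)
      have "h (Suc a) (Suc b) + h a b = h a (Suc b) + 2 * h (Suc a) b"
        unfolding h_def by (rule binomial_convolution_recurrence)
      then have "2 ^ Suc a * (h (Suc a) (Suc b) + h a b)
          = 2 ^ Suc a * (h a (Suc b) + 2 * h (Suc a) b)" by (simp only:)
      then have "2 ^ Suc a * h (Suc a) (Suc b) + 2 * (2 ^ a * h a b)
          = 2 * (2 ^ a * h a (Suc b)) + 2 * (2 ^ Suc a * h (Suc a) b)"
        by (simp add: algebra_simps)
      then show ?case
        using psi_primepow_mult_recurrence[OF assms(1-3), of a b]
        unfolding row Suc.IH by linarith
    qed
  qed
  then show ?thesis by (simp add: h_def atLeast0AtMost)
qed

end
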